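(* Let $n_1$, $n_2$, and $n_3$ be positive integers such that $n_1 \geq n_2 \geq n_3$. Then the complete tripartite graph $K_{n_1,n_2,n_3}$ is competitively orientable if and only if $n_1\geq 5$ and $n_3 \geq 4$.
   Context: All graphs are finite and simple. An orientation of a graph $G$ is a digraph $D$ on the vertex set $V(G)$ with no loops, no multiple arcs and no directed $2$-cycles, whose underlying graph (with edge set $\{uv \mid (u,v)\in A(D)\}$) is $G$. A digraph $D$ is competitive if every pair of distinct vertices $x,y$ has a common out-neighbor, i.e. there is a vertex $z$ with $(x,z),(y,z)\in A(D)$. A graph is competitively orientable if it has a competitive orientation. $K_{n_1,\ldots,n_k}$ denotes the complete $k$-partite graph with partite sets of sizes $n_1,\ldots,n_k$. *)

theory Defs
  imports "Graph_Theory.Digraph_Component"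
begin

text \<open>
  As in the Graph_Theory library, a simple graph is a loop-free symmetric digraph without parallel
  arcs (\<^locale>\<open>pair_graph\<close>): an edge \<open>uv\<close> is the pair of arcs \<open>(u, v)\<close> and \<open>(v, u)\<close>.
  In particular \<^const>\<open>mk_symmetric\<close> maps a digraph to its underlying graph.
\<close>

text \<open>
  The vertex \<open>(i, j)\<close> is the \<open>j\<close>-th vertex of the \<open>i\<close>-th partite set (counting from 0), so
  \<open>complete_multipartite [n\<^sub>1, \<dots>, n\<^sub>k]\<close> is the complete \<open>k\<close>-partite graph on partite
  sets of sizes \<open>n\<^sub>1, \<dots>, n\<^sub>k\<close>.
\<close>

definition complete_multipartite :: "nat list \<Rightarrow> (nat \<times> nat) pair_pre_digraph" where
  "complete_multipartite ns =
    (let V = {(i, j). i < length ns \<and> j < ns ! i}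
     in \<lparr> pverts = V, parcs = {(u, v). u \<in> V \<and> v \<in> V \<and> fst u \<noteq> fst v} \<rparr>)"

lemma pair_graph_complete_multipartite: "pair_graph (complete_multipartite ns)"
proof -
  let ?V = "{(i, j). i < length ns \<and> j < ns ! i}"
  have "?V = (SIGMA i:{..<length ns}. {..<ns ! i})"
    by auto
  then have fin: "finite ?V"
    by simp
  have "finite {(u, v). u \<in> ?V \<and> v \<in> ?V \<and> fst u \<noteq> fst v}"
    by (rule finite_subset[OF _ finite_cartesian_product[OF fin fin]]) auto
  with fin show ?thesis
    by unfold_locales
      (auto simp: complete_multipartite_def Let_def symmetric_def intro!: symI)
qed

text \<open>
  Parallel arcs cannot occur in a \<^typ>\<open>'a pair_pre_digraph\<close>; \<^locale>\<open>pair_digraph\<close> adds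
  finiteness and the absence of loops.
\<close>

definition orientation_of :: "'a pair_pre_digraph \<Rightarrow> 'a pair_pre_digraph \<Rightarrow> bool" where
  "orientation_of D G \<longleftrightarrow> pair_digraph D \<and> asym (parcs D) \<and> mk_symmetric (with_proj D) = G"

definition competitive :: "'a pair_pre_digraph \<Rightarrow> bool" where
  "competitive D \<longleftrightarrow> (\<forall>x \<in> pverts D. \<forall>y \<in> pverts D. x \<noteq> y \<longrightarrow>
     (\<exists>z \<in> pverts D. (x, z) \<in> parcs D \<and> (y, z) \<in> parcs D))"

definition competitively_orientable :: "'a pair_pre_digraph \<Rightarrow> bool" where
  "competitively_orientable G \<longleftrightarrow> (\<exists>D. orientation_of D G \<and> competitive D)"

end

theory Submission
  imports Defs
begin

text \<open>
  In a competitive orientation the out-neighbourhood of a vertex has no sink, so it contains a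
  directed cycle; lying in two parts, it has at least two vertices in each of them. If \<open>c\<close>, \<open>c'\<close> are
  two vertices of a part and \<open>z\<close> is a common out-neighbour, then the out-neighbours of \<open>z\<close> in this
  part are two further vertices, so every part has at least four vertices.

  In \<open>K\<^bsub>4,4,4\<^esub>\<close> all these bounds are attained. Encode the arcs between two parts by a
  \<open>4 \<times> 4\<close> matrix of signs. For each part \<open>C\<close>, the rows of the other two parts over \<open>C\<close> are orthogonal
  to each other and to the all-ones vector, so that one of the two matrices has rank one. Hence two of
  the three matrices have rank one. The part that they share has two vertices whose rows are
  opposite in both of them, and these have no common out-neighbour.

  Conversely, \<open>K\<^bsub>5,4,4\<^esub>\<close> has a competitive orientation, and cloning a vertex keeps an
  orientation competitive.
\<close>

section \<open>Competitive tripartite orientations\<close>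

text \<open>The parts are abstract sets in symmetric roles, so \<open>swap\<close> and
  \<open>rotate\<close> carry each lemma on the ordered triple over to all its permutations.\<close>

locale competitive_tripartite =
  fixes A B C :: "'a set" and E :: "('a \<times> 'a) set"
  assumes fin: "finite A" "finite B" "finite C"
    and nonempty: "A \<noteq> {}" "B \<noteq> {}" "C \<noteq> {}"
    and disjoint: "A \<inter> B = {}" "A \<inter> C = {}" "B \<inter> C = {}"
    and asym: "asym E"
    and underlying: "E \<union> E\<inverse> = A \<times> B \<union> B \<times> A \<union> A \<times> C \<union> C \<times> A \<union> B \<times> C \<union> C \<times> B"
    and common_out:
      "\<lbrakk>x \<in> A \<union> B \<union> C; y \<in> A \<union> B \<union> C; x \<noteq> y\<rbrakk> \<Longrightarrow> \<exists>z. (x, z) \<in> E \<and> (y, z) \<in> E"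
begin

lemma swap: "competitive_tripartite B A C E"
  using fin nonempty disjoint asym underlying common_out
  by unfold_locales (auto simp: Int_commute)

lemma rotate: "competitive_tripartite B C A E"
  using fin nonempty disjoint asym underlying common_out
  by unfold_locales (auto simp: Int_commute)

lemma arc_cases:
  assumes "(x, y) \<in> E"
  shows "(x, y) \<in> A \<times> B \<union> B \<times> A \<union> A \<times> C \<union> C \<times> A \<union> B \<times> C \<union> C \<times> B"
  using assms underlying by blast

lemma arc_flip:
  assumes "x \<in> A" and "y \<in> B"
  shows "(y, x) \<in> E \<longleftrightarrow> (x, y) \<notin> E"
proof -
  have "(x, y) \<in> E \<union> E\<inverse>"
    unfolding underlying using assms by blast
  then show ?thesis
    using asymD[OF asym] by blast
qed

text \<open>If \<open>y\<close> were the only out-neighbour of \<open>x\<close> in \<open>B\<close>,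
  a walk of common out-neighbours starting at \<open>y\<close> would go to some \<open>z\<close> in
  \<open>C\<close> and straight back to \<open>y\<close>, a directed 2-cycle.\<close>

lemma out_two:
  assumes "x \<in> A"
  shows "\<exists>y\<in>B. \<exists>y'\<in>B. y \<noteq> y' \<and> (x, y) \<in> E \<and> (x, y') \<in> E"
proof (rule ccontr)
  assume "\<not> ?thesis"
  then have unique: "y = y'" if "y \<in> B" "y' \<in> B" "(x, y) \<in> E" "(x, y') \<in> E" for y y'
    using that by blast
  have out: "z \<in> B \<or> z \<in> C" if "(x, z) \<in> E" for z
    using arc_cases[OF that] assms disjoint by blast
  have step: "\<exists>z. (x, z) \<in> E \<and> (w, z) \<in> E" if "(x, w) \<in> E" for w
  proof -
    have "w \<noteq> x"
      using that asym by (meson asymD)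
    then show ?thesis
      using common_out[of x w] assms out[OF that] by blast
  qed
  obtain b where b: "b \<in> B"
    using nonempty by blast
  then have "b \<noteq> x"
    using assms disjoint by blast
  then obtain w where w: "(x, w) \<in> E"
    using common_out[of x b] assms b by blast
  obtain w' where w': "(x, w') \<in> E" "(w, w') \<in> E"
    using step[OF w] by blast
  \<comment> \<open>Adjacent vertices lie in different parts, and all out-neighbours of
    \<open>x\<close> are in \<open>B\<close> or \<open>C\<close>.\<close>
  have "w \<in> B \<or> w' \<in> B"
    using out[OF w] out[OF w'(1)] arc_cases[OF w'(2)] disjoint by blast
  then obtain y where y: "y \<in> B" "(x, y) \<in> E"
    using w w' by blast
  obtain z where z: "(x, z) \<in> E" "(y, z) \<in> E"
    using step[OF y(2)] by blast
  have "z \<in> C"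
    using out[OF z(1)] arc_cases[OF z(2)] y(1) disjoint by blast
  obtain u where u: "(x, u) \<in> E" "(z, u) \<in> E"
    using step[OF z(1)] by blast
  have "u \<in> B"
    using out[OF u(1)] arc_cases[OF u(2)] \<open>z \<in> C\<close> disjoint by blast
  then have "u = y"
    using unique y u(1) by blast
  then show False
    using u(2) z(2) asym by (meson asymD)
qed

lemma card_out:
  assumes "x \<in> A"
  shows "card (E `` {x} \<inter> B) \<ge> 2"
proof -
  obtain y y' where "y \<noteq> y'" "{y, y'} \<subseteq> E `` {x} \<inter> B"
    using out_two[OF assms] by blast
  then show ?thesis
    using card_mono[of "E `` {x} \<inter> B" "{y, y'}"] fin by simp
qed

lemma card_part: "card A \<ge> 4"
proof -
  interpret BA: competitive_tripartite B A C E by (rule swap)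
  interpret CA: competitive_tripartite C A B E
    using rotate competitive_tripartite.rotate by blast
  obtain b where "b \<in> B"
    using nonempty by blast
  then obtain c c' where c: "c \<in> A" "c' \<in> A" "c \<noteq> c'"
    using BA.out_two by blast
  then obtain z where z: "(c, z) \<in> E" "(c', z) \<in> E"
    using common_out[of c c'] by blast
  have "z \<in> B \<or> z \<in> C"
    using arc_cases[OF z(1)] c(1) disjoint by blast
  then obtain d d' where d: "d \<in> A" "d' \<in> A" "d \<noteq> d'" "(z, d) \<in> E" "(z, d') \<in> E"
    using BA.out_two CA.out_two by blast
  have "d \<noteq> c" "d \<noteq> c'" "d' \<noteq> c" "d' \<noteq> c'"
    using z d(4,5) asym by (meson asymD)+
  then have "card {c, c', d, d'} = 4"
    using c(3) d(3) by auto
  then show ?thesis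
    using card_mono[of A "{c, c', d, d'}"] fin c d by simp
qed

end

section \<open>The case of four vertices in each part\<close>

text \<open>The \<open>\<plusminus>1\<close> matrix that records which pairs of \<open>X \<times> Y\<close> are in \<open>E\<close> has rank one.\<close>

definition rank_one :: "('a \<times> 'a) set \<Rightarrow> 'a set \<Rightarrow> 'a set \<Rightarrow> bool" where
  "rank_one E X Y \<longleftrightarrow> (\<forall>x\<in>X. \<forall>x'\<in>X. \<forall>y\<in>Y. \<forall>y'\<in>Y.
     ((x, y) \<in> E \<longleftrightarrow> (x, y') \<in> E) \<longleftrightarrow> ((x', y) \<in> E \<longleftrightarrow> (x', y') \<in> E))"

text \<open>Such halves meet in exactly one point. This gives coordinates for two rows that are
  neither equal nor opposite.\<close>

lemma two_halves_of_four:
  assumes "card S = 4" and "P \<subseteq> S" "Q \<subseteq> S" and "card P = 2" "card Q = 2"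
    and "Q \<noteq> P" "Q \<noteq> S - P"
  obtains w x y z where "distinct [w, x, y, z]" "S = {w, x, y, z}" "P = {w, x}" "Q = {w, y}"
proof -
  have fin: "finite S"
    using assms(1) by (simp add: card_ge_0_finite)
  have "P \<inter> Q \<noteq> {}"
  proof
    assume "P \<inter> Q = {}"
    then have "Q \<subseteq> S - P"
      using assms by blast
    moreover have "card (S - P) = 2"
      using assms fin by (simp add: card_Diff_subset finite_subset)
    ultimately show False
      using assms fin by (metis card_subset_eq finite_Diff)
  qed
  then obtain w where w: "w \<in> P" "w \<in> Q"
    by blast
  obtain x where x: "P = {w, x}" "x \<noteq> w"
    using assms(4) w by (auto simp: card_2_iff)
  obtain y where y: "Q = {w, y}" "y \<noteq> w"
    using assms(5) w by (auto simp: card_2_iff)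
  have "x \<noteq> y"
    using assms x y by blast
  then have "card {w, x, y} = 3" "{w, x, y} \<subseteq> S"
    using x y assms by auto
  then have "card (S - {w, x, y}) = 1"
    using assms(1) by (simp add: card_Diff_subset)
  then obtain z where "S - {w, x, y} = {z}"
    by (auto simp: card_1_singleton_iff)
  then have "S = {w, x, y, z}" "z \<notin> {w, x, y}"
    using \<open>{w, x, y} \<subseteq> S\<close> by blast+
  then show thesis
    using that[of w x y z] x y \<open>x \<noteq> y\<close> by auto
qed

locale competitive_444 = competitive_tripartite +
  assumes card_parts: "card A = 4" "card B = 4" "card C = 4"
begin

lemma swap_444: "competitive_444 B A C E"
  using swap card_parts by (simp add: competitive_444_def competitive_444_axioms_def)

lemma rotate_444: "competitive_444 B C A E"
  using rotate card_parts by (simp add: competitive_444_def competitive_444_axioms_def)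

lemma in_card_le:
  assumes "y \<in> B"
  shows "card {x \<in> A. (x, y) \<in> E} \<le> 2"
proof -
  interpret BA: competitive_tripartite B A C E by (rule swap)
  have "{x \<in> A. (x, y) \<in> E} = A - E `` {y} \<inter> A"
    using arc_flip assms by blast
  then have "card {x \<in> A. (x, y) \<in> E} = 4 - card (E `` {y} \<inter> A)"
    using fin card_parts by (simp add: card_Diff_subset)
  then show ?thesis
    using BA.card_out[OF assms] by simp
qed

text \<open>Double counting of the arcs from \<open>A\<close> to \<open>B\<close>: the tails give at
  least 8, the heads at most 8 by \<open>in_card_le\<close>, so no vertex exceeds its bound.\<close>

lemma card_out_eq:
  assumes "x \<in> A"
  shows "card (E `` {x} \<inter> B) = 2"
proof (rule ccontr)
  assume "\<not> ?thesis"
  then have gt: "2 < card (E `` {x} \<inter> B)"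
    using card_out[OF assms] by linarith
  have out: "E `` {u} \<inter> B = {y \<in> B. (u, y) \<in> E}" for u
    by blast
  have "(\<Sum>u\<in>A. 2) < (\<Sum>u\<in>A. card (E `` {u} \<inter> B))"
    by (rule sum_strict_mono_ex1) (use fin assms gt card_out in auto)
  also have "\<dots> = (\<Sum>y\<in>B. card {u \<in> A. (u, y) \<in> E})"
    unfolding out by (rule sum_multicount_gen) (use fin in auto)
  also have "\<dots> \<le> (\<Sum>y\<in>B. 2)"
    by (rule sum_mono) (rule in_card_le)
  finally show False
    using card_parts by simp
qed

text \<open>
  Each of the two out-neighbours of \<open>a\<close> in \<open>C\<close> has at most two in-neighbours in \<open>B\<close>, and every one of
  the four vertices of \<open>B\<close> is among these.
\<close>

lemma common_out_unique:
  assumes "a \<in> A" "b \<in> B" "c \<in> C" "c' \<in> C"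
    and "(a, c) \<in> E" "(a, c') \<in> E" "(b, c) \<in> E" "(b, c') \<in> E"
  shows "c = c'"
proof (rule ccontr)
  assume "c \<noteq> c'"
  interpret BC: competitive_444 B C A E by (rule rotate_444)
  interpret CA: competitive_444 C A B E by (rule BC.rotate_444)
  interpret AC: competitive_444 A C B E by (rule CA.swap_444)
  have "{c, c'} \<subseteq> E `` {a} \<inter> C" "card (E `` {a} \<inter> C) = 2"
    using assms AC.card_out_eq by auto
  then have out: "E `` {a} \<inter> C = {c, c'}"
    using fin \<open>c \<noteq> c'\<close> by (metis card_2_iff card_subset_eq finite_Int)
  let ?I = "{x \<in> B. (x, c) \<in> E}" and ?I' = "{x \<in> B. (x, c') \<in> E}"
  have "B \<subseteq> ?I \<union> ?I'"
  proof
    fix x assume x: "x \<in> B"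
    then have "x \<noteq> a"
      using assms disjoint by blast
    then obtain z where z: "(a, z) \<in> E" "(x, z) \<in> E"
      using common_out[of a x] x assms by blast
    have "z \<in> C"
      using arc_cases[OF z(1)] arc_cases[OF z(2)] x assms disjoint by blast
    then have "z \<in> {c, c'}"
      using out z(1) by blast
    then show "x \<in> ?I \<union> ?I'"
      using z(2) x by blast
  qed
  then have "card B \<le> card (?I \<union> ?I')"
    using fin by (intro card_mono) auto
  \<comment> \<open>The inequality is strict because \<open>b\<close> lies in both
    in-neighbourhoods.\<close>
  also have "\<dots> < card ?I + card ?I'"
  proof -
    have "0 < card (?I \<inter> ?I')"
      using fin assms by (subst card_gt_0_iff) auto
    then show ?thesis
      using card_Un_Int[of ?I ?I'] fin by simp
  qed
  also have "\<dots> \<le> 2 + 2"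
    using BC.in_card_le assms by (intro add_mono) auto
  finally show False
    using card_parts by simp
qed

text \<open>Transposing reverses every sign, which preserves the product of the four signs in each 2
  by 2 submatrix.\<close>

lemma rank_one_flip:
  assumes "rank_one E A B"
  shows "rank_one E B A"
  unfolding rank_one_def
proof (intro ballI)
  fix y y' x x' assume xy: "y \<in> B" "y' \<in> B" "x \<in> A" "x' \<in> A"
  then have "((x, y) \<in> E \<longleftrightarrow> (x, y') \<in> E) \<longleftrightarrow> ((x', y) \<in> E \<longleftrightarrow> (x', y') \<in> E)"
    using assms unfolding rank_one_def by blast
  then show "((y, x) \<in> E \<longleftrightarrow> (y, x') \<in> E) \<longleftrightarrow> ((y', x) \<in> E \<longleftrightarrow> (y', x') \<in> E)"
    using xy by (auto simp: arc_flip)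
qed

text \<open>Suppose two rows of \<open>B\<close> over \<open>C\<close> are \<open>{w, x}\<close> and
  \<open>{w, y}\<close>. A row of \<open>A\<close> is a pair meeting each of them exactly once, so
  it is \<open>{w, z}\<close> or its complement \<open>{x, y}\<close>.\<close>

lemma rank_one_target: "rank_one E A C \<or> rank_one E B C"
proof (rule disjCI)
  interpret BC: competitive_444 B C A E by (rule rotate_444)
  interpret CA: competitive_444 C A B E by (rule BC.rotate_444)
  interpret AC: competitive_444 A C B E by (rule CA.swap_444)
  let ?N = "\<lambda>v. E `` {v} \<inter> C"
  assume "\<not> rank_one E B C"
  then obtain b b' c c' where b: "b \<in> B" "b' \<in> B" and c: "c \<in> C" "c' \<in> C"
    and odd: "((b, c) \<in> E \<longleftrightarrow> (b, c') \<in> E) \<noteq> ((b', c) \<in> E \<longleftrightarrow> (b', c') \<in> E)"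
    unfolding rank_one_def by blast
  \<comment> \<open>Equal or complementary rows would agree on whether \<open>c\<close> and
    \<open>c'\<close> have the same sign.\<close>
  have "?N b' \<noteq> ?N b" "?N b' \<noteq> C - ?N b"
    using odd c by blast+
  then obtain w x y z where dist: "distinct [w, x, y, z]" and S: "C = {w, x, y, z}"
    and N: "?N b = {w, x}" "?N b' = {w, y}"
    using two_halves_of_four[of C "?N b" "?N b'"] card_parts BC.card_out_eq b by blast
  have rows: "?N a = {w, z} \<or> ?N a = {x, y}" if a: "a \<in> A" for a
  proof -
    have meet: "\<exists>!u. u \<in> ?N a \<inter> ?N v" if v: "v \<in> B" for v
    proof -
      have "a \<noteq> v"
        using a v disjoint by blast
      then obtain u where u: "(a, u) \<in> E" "(v, u) \<in> E"
        using common_out[of a v] a v by blast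
      then have "u \<in> C"
        using arc_cases[OF u(1)] arc_cases[OF u(2)] a v disjoint by blast
      then show ?thesis
        using u common_out_unique[OF a v] by blast
    qed
    obtain p q where pq: "?N a = {p, q}" "p \<noteq> q"
      using AC.card_out_eq[OF a] by (auto simp: card_2_iff)
    then have "{p, q} \<subseteq> {w, x, y, z}"
      using S by blast
    then show ?thesis
      using meet[OF b(1)] meet[OF b(2)] dist pq(2) unfolding N pq(1) by auto
  qed
  show "rank_one E A C"
    unfolding rank_one_def
  proof (intro ballI)
    fix a a' u v assume a: "a \<in> A" "a' \<in> A" and uv: "u \<in> C" "v \<in> C"
    have row: "((p, u) \<in> E \<longleftrightarrow> (p, v) \<in> E) \<longleftrightarrow> (u \<in> {w, z} \<longleftrightarrow> v \<in> {w, z})" if "p \<in> A" for p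
    proof -
      have "{x, y} = C - {w, z}"
        using S dist by auto
      then have "?N p = {w, z} \<or> ?N p = C - {w, z}"
        using rows[OF that] by simp
      then show ?thesis
        using uv by blast
    qed
    show "((a, u) \<in> E \<longleftrightarrow> (a, v) \<in> E) \<longleftrightarrow> ((a', u) \<in> E \<longleftrightarrow> (a', v) \<in> E)"
      unfolding row[OF a(1)] row[OF a(2)] ..
  qed
qed

text \<open>Two vertices of \<open>A\<close> separated both by \<open>b\<close> and by
  \<open>c\<close> have opposite rows over \<open>B\<close> and over \<open>C\<close>, hence no
  common out-neighbour.\<close>

lemma not_rank_one_both: "\<not> (rank_one E A B \<and> rank_one E A C)"
proof
  assume r: "rank_one E A B \<and> rank_one E A C"
  interpret BA: competitive_444 B A C E by (rule swap_444)
  interpret BC: competitive_444 B C A E by (rule rotate_444)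
  interpret CA: competitive_444 C A B E by (rule BC.rotate_444)
  obtain b c where b: "b \<in> B" and c: "c \<in> C"
    using nonempty by blast
  let ?P = "E `` {b} \<inter> A" and ?Q = "E `` {c} \<inter> A"
  have cards: "card ?P = 2" "card ?Q = 2"
    using BA.card_out_eq b CA.card_out_eq c by auto
  obtain a a' where a: "a \<in> ?P" "a' \<in> A - ?P" "a \<in> ?Q \<longleftrightarrow> a' \<notin> ?Q"
  proof (rule ccontr)
    assume "\<not> thesis"
    then have same: "a \<in> ?Q \<longleftrightarrow> a' \<in> ?Q" if "a \<in> ?P" "a' \<in> A - ?P" for a a'
      using that \<open>\<And>a a'. _ a a' \<Longrightarrow> _ a a' \<Longrightarrow> _ a a' \<Longrightarrow> thesis\<close> by blast
    \<comment> \<open>With both sides of \<open>?P\<close> inhabited, agreement across them makes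
      membership in \<open>?Q\<close> constant on \<open>A\<close>.\<close>
    have "?P \<noteq> {}" "?P \<noteq> A"
      using cards card_parts by auto
    then have "?Q = {} \<or> ?Q = A"
      using same by blast
    then show False
      using cards card_parts by auto
  qed
  then have "a \<noteq> a'" "a \<in> A" "a' \<in> A"
    by blast+
  then obtain z where z: "(a, z) \<in> E" "(a', z) \<in> E"
    using common_out[of a a'] by blast
  have sep_b: "(a, b) \<in> E \<longleftrightarrow> (a', b) \<notin> E"
    using a arc_flip \<open>a \<in> A\<close> \<open>a' \<in> A\<close> b by blast
  have sep_c: "(a, c) \<in> E \<longleftrightarrow> (a', c) \<notin> E"
    using a CA.arc_flip \<open>a \<in> A\<close> \<open>a' \<in> A\<close> c by blast
  have "z \<in> B \<or> z \<in> C"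
    using arc_cases[OF z(1)] \<open>a \<in> A\<close> disjoint by blast
  then show False
  proof
    assume "z \<in> B"
    then have "((a, z) \<in> E \<longleftrightarrow> (a, b) \<in> E) \<longleftrightarrow> ((a', z) \<in> E \<longleftrightarrow> (a', b) \<in> E)"
      using r b \<open>a \<in> A\<close> \<open>a' \<in> A\<close> unfolding rank_one_def by blast
    then show False
      using z sep_b by blast
  next
    assume "z \<in> C"
    then have "((a, z) \<in> E \<longleftrightarrow> (a, c) \<in> E) \<longleftrightarrow> ((a', z) \<in> E \<longleftrightarrow> (a', c) \<in> E)"
      using r c \<open>a \<in> A\<close> \<open>a' \<in> A\<close> unfolding rank_one_def by blast
    then show False
      using z sep_c by blast
  qed
qed

text \<open>Among any two of the three matrices one has rank one, so at most one fails; the other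
  two share a part. The flips identify each matrix with its transpose.\<close>

lemma contradiction: False
proof -
  interpret BA: competitive_444 B A C E by (rule swap_444)
  interpret BC: competitive_444 B C A E by (rule rotate_444)
  interpret CA: competitive_444 C A B E by (rule BC.rotate_444)
  interpret AC: competitive_444 A C B E by (rule CA.swap_444)
  interpret CB: competitive_444 C B A E by (rule BC.swap_444)
  show False
    using rank_one_target BC.rank_one_target CA.rank_one_target
      not_rank_one_both BC.not_rank_one_both CA.not_rank_one_both
      rank_one_flip BA.rank_one_flip BC.rank_one_flip CB.rank_one_flip
      CA.rank_one_flip AC.rank_one_flip
    by blast
qed

end

section \<open>Competitive orientations of complete tripartite graphs\<close>

lemma orientation_of_iff:
  "orientation_of D G \<longleftrightarrow>
     pair_digraph D \<and> asym (parcs D) \<and> pverts D = pverts G \<and> parcs D \<union> (parcs D)\<inverse> = parcs G"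
proof -
  have "parcs (mk_symmetric (with_proj D)) = parcs D \<union> (parcs D)\<inverse>"
    by (auto simp: parcs_mk_symmetric)
  then show ?thesis
    unfolding orientation_of_def by (auto intro: pair_pre_digraph.equality)
qed

text \<open>The six products are listed as in the assumption \<open>underlying\<close>, so that it
  follows by rewriting alone.\<close>

lemma complete_tripartite_simps:
  fixes k l m :: nat
  defines "P \<equiv> \<lambda>i n. {i} \<times> {..<n}"
  shows "pverts (complete_multipartite [k, l, m]) = P 0 k \<union> P 1 l \<union> P 2 m" (is ?verts)
    and "parcs (complete_multipartite [k, l, m]) =
      P 0 k \<times> P 1 l \<union> P 1 l \<times> P 0 k \<union> P 0 k \<times> P 2 m \<union> P 2 m \<times> P 0 k \<union> P 1 l \<times> P 2 m \<union> P 2 m \<times> P 1 l"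
      (is "_ = ?arcs")
proof -
  have "pverts (complete_multipartite [k, l, m]) = {v. fst v < 3 \<and> snd v < [k, l, m] ! fst v}"
    by (auto simp: complete_multipartite_def Let_def)
  also have "\<dots> = {v. (fst v = 0 \<or> fst v = 1 \<or> fst v = 2) \<and> snd v < [k, l, m] ! fst v}"
    by (intro Collect_cong) linarith
  also have "\<dots> = P 0 k \<union> P 1 l \<union> P 2 m"
    by (auto simp: P_def)
  finally show verts: ?verts .
  have P_iff: "u \<in> P i n \<longleftrightarrow> fst u = i \<and> snd u < n" for u i n
    by (cases u) (simp add: P_def)
  have "parcs (complete_multipartite [k, l, m]) =
      {(u, v). u \<in> P 0 k \<union> P 1 l \<union> P 2 m \<and> v \<in> P 0 k \<union> P 1 l \<union> P 2 m \<and> fst u \<noteq> fst v}"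
      (is "_ = ?pairs")
    unfolding verts[symmetric] by (simp add: complete_multipartite_def Let_def)
  also have "\<dots> = ?arcs"
  proof -
    have "(u, v) \<in> ?pairs \<longleftrightarrow> (u, v) \<in> ?arcs" for u v
      unfolding mem_Times_iff Un_iff mem_Collect_eq case_prod_conv fst_conv snd_conv P_iff
      by (cases "fst u = 0"; cases "fst u = 1"; cases "fst u = 2";
          cases "fst v = 0"; cases "fst v = 1"; cases "fst v = 2"; simp)
    then show ?thesis
      by (intro equalityI subrelI) (simp_all only:)
  qed
  finally show "parcs (complete_multipartite [k, l, m]) = ?arcs" .
qed

section \<open>An explicit orientation for parts of sizes 5, 4, 4 and its clones\<close>

text \<open>
  For \<open>i < j\<close>, the entry \<open>arc_table i j ! a\<close> lists the out-neighbours in part \<open>j\<close> of the \<open>a\<close>-th vertex of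
  part \<open>i\<close>, in a competitive orientation of \<open>K\<^bsub>5,4,4\<^esub>\<close> found by computer search.
\<close>

definition arc_table :: "nat \<Rightarrow> nat \<Rightarrow> nat list list" where
  "arc_table i j =
    (if i = 0 then
       if j = 1 then [[1, 3], [0, 3], [0, 2], [0, 3], [1, 2]]
       else [[2, 3], [1, 2], [2, 3], [0, 3], [0, 1]]
     else [[1, 3], [1, 3], [0, 2], [0, 2]])"

definition beats :: "nat \<times> nat \<Rightarrow> nat \<times> nat \<Rightarrow> bool" where
  "beats u v =
    (if fst u < fst v then snd v \<in> set (arc_table (fst u) (fst v) ! snd u)
     else fst v < fst u \<and> snd u \<notin> set (arc_table (fst v) (fst u) ! snd v))"

definition verts_544 :: "(nat \<times> nat) list" where
  "verts_544 = map (Pair 0) [0..<5] @ map (Pair 1) [0..<4] @ map (Pair 2) [0..<4]"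

lemma set_verts_544: "set verts_544 = {0} \<times> {..<5} \<union> {1} \<times> {..<4} \<union> {2} \<times> {..<4}"
  by (simp add: verts_544_def set_eq_iff image_iff)

lemma beats_iff: "fst u \<noteq> fst v \<Longrightarrow> beats u v \<longleftrightarrow> \<not> beats v u"
  by (auto simp: beats_def)

text \<open>The case \<open>u = v\<close> is included on purpose: two clones retract to the same
  vertex.\<close>

lemma beats_common:
  "\<forall>u\<in>set verts_544. \<forall>v\<in>set verts_544. \<exists>w\<in>set verts_544. beats u w \<and> beats v w"
  by code_simp

text \<open>All vertices of a part from the last one of \<open>K\<^bsub>5,4,4\<^esub>\<close> on are clones of that one.\<close>

definition retract :: "nat \<times> nat \<Rightarrow> nat \<times> nat" where
  "retract v = (fst v, min (snd v) (if fst v = 0 then 4 else 3))"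

definition cloned_orientation :: "nat list \<Rightarrow> (nat \<times> nat) pair_pre_digraph" where
  "cloned_orientation ns = (let G = complete_multipartite ns
     in \<lparr>pverts = pverts G, parcs = {(u, v) \<in> parcs G. beats (retract u) (retract v)}\<rparr>)"

text \<open>\<open>retract\<close> preserves parts, so \<open>beats_iff\<close> gives every edge
  exactly one direction.\<close>

lemma orientation_of_cloned:
  "orientation_of (cloned_orientation ns) (complete_multipartite ns)"
proof -
  interpret G: pair_graph "complete_multipartite ns"
    by (rule pair_graph_complete_multipartite)
  have parts: "fst u \<noteq> fst v" if "(u, v) \<in> parcs (complete_multipartite ns)" for u v
    using that by (auto simp: complete_multipartite_def Let_def)
  have flip: "beats (retract u) (retract v) \<longleftrightarrow> \<not> beats (retract v) (retract u)"
    if "fst u \<noteq> fst v" for u v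
    using that by (intro beats_iff) (simp add: retract_def)
  have sym: "(v, u) \<in> parcs (complete_multipartite ns)"
    if "(u, v) \<in> parcs (complete_multipartite ns)" for u v
    using that by (auto simp: complete_multipartite_def Let_def)
  have "pair_digraph (cloned_orientation ns)"
  proof
    show "finite (pverts (cloned_orientation ns))"
      by (simp add: cloned_orientation_def Let_def)
    show "finite (parcs (cloned_orientation ns))"
      by (rule finite_subset[OF _ G.pair_finite_arcs]) (auto simp: cloned_orientation_def Let_def)
  qed (auto simp: cloned_orientation_def Let_def dest: G.in_arcsD1 G.in_arcsD2 parts)
  moreover have "asym (parcs (cloned_orientation ns))"
    by (rule asymI) (auto simp: cloned_orientation_def Let_def dest: flip parts)
  ultimately show ?thesis
    unfolding orientation_of_iff cloned_orientation_def Let_def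
    using flip parts sym by auto
qed

lemma competitive_cloned:
  assumes "n1 \<ge> 5" "n2 \<ge> 4" "n3 \<ge> 4"
  shows "competitive (cloned_orientation [n1, n2, n3])"
  unfolding competitive_def
proof (intro ballI impI)
  let ?G = "complete_multipartite [n1, n2, n3]"
  fix x y
  assume "x \<in> pverts (cloned_orientation [n1, n2, n3])"
    and "y \<in> pverts (cloned_orientation [n1, n2, n3])"
  then have xy: "x \<in> pverts ?G" "y \<in> pverts ?G"
    by (auto simp: cloned_orientation_def Let_def)
  have retract: "retract v \<in> set verts_544" if "v \<in> pverts ?G" for v
    using that by (auto simp: complete_tripartite_simps retract_def set_verts_544)
  obtain z where z: "z \<in> set verts_544" "beats (retract x) z" "beats (retract y) z"
    using beats_common retract xy by blast
  \<comment> \<open>The size bounds put the 5 + 4 + 4 base vertices into the graph, and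
    \<open>retract\<close> fixes them; so \<open>z\<close> serves \<open>x\<close> and
    \<open>y\<close> themselves.\<close>
  have "z \<in> pverts ?G" "retract z = z"
    using z(1) assms by (auto simp: complete_tripartite_simps retract_def set_verts_544)
  moreover have "fst x \<noteq> fst z" "fst y \<noteq> fst z"
    using z(2,3) by (auto simp: beats_def retract_def)
  ultimately have "(x, z) \<in> parcs (cloned_orientation [n1, n2, n3])"
    "(y, z) \<in> parcs (cloned_orientation [n1, n2, n3])" "z \<in> pverts (cloned_orientation [n1, n2, n3])"
    using xy z(2,3)
    by (auto simp: cloned_orientation_def complete_multipartite_def Let_def)
  then show "\<exists>z\<in>pverts (cloned_orientation [n1, n2, n3]).
      (x, z) \<in> parcs (cloned_orientation [n1, n2, n3]) \<and>
      (y, z) \<in> parcs (cloned_orientation [n1, n2, n3])"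
    by blast
qed

section \<open>The characterization of competitively orientable complete tripartite graphs\<close>

lemma competitive_orientation_tripartite:
  assumes "orientation_of D (complete_multipartite [n1, n2, n3])" and "competitive D"
    and "n1 > 0" "n2 > 0" "n3 > 0"
  shows "competitive_tripartite ({0} \<times> {..<n1}) ({1} \<times> {..<n2}) ({2} \<times> {..<n3}) (parcs D)"
proof
  have V: "pverts D = {0} \<times> {..<n1} \<union> {1} \<times> {..<n2} \<union> {2} \<times> {..<n3}"
    using assms(1) by (simp only: orientation_of_iff complete_tripartite_simps)
  show "parcs D \<union> (parcs D)\<inverse> =
      ({0} \<times> {..<n1}) \<times> ({1} \<times> {..<n2}) \<union> ({1} \<times> {..<n2}) \<times> ({0} \<times> {..<n1}) \<union>
      ({0} \<times> {..<n1}) \<times> ({2} \<times> {..<n3}) \<union> ({2} \<times> {..<n3}) \<times> ({0} \<times> {..<n1}) \<union>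
      ({1} \<times> {..<n2}) \<times> ({2} \<times> {..<n3}) \<union> ({2} \<times> {..<n3}) \<times> ({1} \<times> {..<n2})"
    using assms(1) by (simp only: orientation_of_iff complete_tripartite_simps)
  show "\<exists>z. (x, z) \<in> parcs D \<and> (y, z) \<in> parcs D"
    if "x \<in> {0} \<times> {..<n1} \<union> {1} \<times> {..<n2} \<union> {2} \<times> {..<n3}"
      "y \<in> {0} \<times> {..<n1} \<union> {1} \<times> {..<n2} \<union> {2} \<times> {..<n3}" "x \<noteq> y" for x y
    using that assms(2) unfolding V[symmetric] competitive_def by blast
  show "asym (parcs D)"
    using assms(1) by (simp only: orientation_of_iff)
  show "{0} \<times> {..<n1} \<noteq> {}" "{1} \<times> {..<n2} \<noteq> {}" "{2} \<times> {..<n3} \<noteq> {}"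
    using assms(3-5) by (simp_all add: lessThan_empty_iff)
qed auto

theorem theorem2:
  fixes n1 n2 n3 :: nat
  assumes "n1 > 0" and "n2 > 0" and "n3 > 0"
    and "n1 \<ge> n2" and "n2 \<ge> n3"
  shows "competitively_orientable (complete_multipartite [n1, n2, n3]) \<longleftrightarrow> n1 \<ge> 5 \<and> n3 \<ge> 4"
proof
  assume "competitively_orientable (complete_multipartite [n1, n2, n3])"
  then obtain D where D: "orientation_of D (complete_multipartite [n1, n2, n3])" "competitive D"
    unfolding competitively_orientable_def by blast
  interpret competitive_tripartite "{0} \<times> {..<n1}" "{1} \<times> {..<n2}" "{2} \<times> {..<n3}" "parcs D"
    using competitive_orientation_tripartite D assms by blast
  \<comment> \<open>\<open>card_part\<close> bounds the first part of the triple, so the smallest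
    part is rotated to the front.\<close>
  interpret CA: competitive_tripartite "{2} \<times> {..<n3}" "{0} \<times> {..<n1}" "{1} \<times> {..<n2}" "parcs D"
    using rotate competitive_tripartite.rotate by blast
  have "n3 \<ge> 4"
    using CA.card_part by (simp add: card_cartesian_product)
  moreover have "n1 \<ge> 5"
  proof (rule ccontr)
    assume "\<not> n1 \<ge> 5"
    then have "n1 = 4" "n2 = 4" "n3 = 4"
      using \<open>n3 \<ge> 4\<close> assms by auto
    then interpret competitive_444 "{0} \<times> {..<n1}" "{1} \<times> {..<n2}" "{2} \<times> {..<n3}" "parcs D"
      by unfold_locales (simp_all add: card_cartesian_product)
    show False
      by (rule contradiction)
  qed
  ultimately show "n1 \<ge> 5 \<and> n3 \<ge> 4"
    by simp
next
  assume "n1 \<ge> 5 \<and> n3 \<ge> 4"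
  then show "competitively_orientable (complete_multipartite [n1, n2, n3])"
    unfolding competitively_orientable_def
    using orientation_of_cloned competitive_cloned assms by (meson order_trans)
qed

end
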